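(* Let $a,b$ be integers with $3\le a<b$, and let $G$ be a graph of order $n\ge 2b^2+4b$. If $\rho(G)\ge \rho(H_{n,b})$, then $G$ has all $[a,b]$-factors unless $G\cong H_{n,b}$.
   Context: All graphs are finite, undirected and simple. $\rho(G)$ denotes the spectral radius (largest eigenvalue of the adjacency matrix) of $G$. For graphs $G_1,G_2$, the join $G_1\nabla G_2$ is obtained from the disjoint union $G_1\cup G_2$ by adding all edges between $V(G_1)$ and $V(G_2)$. For integers $2\le b\le n-1$, $H_{n,b}:=K_{b-1}\nabla(K_1\cup K_{n-b})$. For a function $h:V(G)\to\mathbb{Z}^+$, an $h$-factor of $G$ is a spanning subgraph $F$ with $d_F(v)=h(v)$ for all $v\in V(G)$. For positive integers $a\le b$, $G$ has all $[a,b]$-factors if $G$ has an $h$-factor for every function $h:V(G)\to\mathbb{Z}^+$ with $a\le h(v)\le b$ for all $v\in V(G)$ and $\sum_{v\in V(G)}h(v)\equiv 0 \pmod 2$. *)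

theory Defs
  imports "Jordan_Normal_Form.Spectral_Radius"
begin

definition simple_graph :: "nat \<Rightarrow> (nat \<Rightarrow> nat \<Rightarrow> bool) \<Rightarrow> bool" where
  "simple_graph n E \<longleftrightarrow>
     (\<forall>i j. E i j \<longrightarrow> i < n \<and> j < n) \<and> (\<forall>i j. E i j \<longrightarrow> E j i) \<and> (\<forall>i. \<not> E i i)"

definition adj_matrix :: "nat \<Rightarrow> (nat \<Rightarrow> nat \<Rightarrow> bool) \<Rightarrow> complex mat" where
  "adj_matrix n E = mat n n (\<lambda>(i, j). if E i j then 1 else 0)"

definition graph_rho :: "nat \<Rightarrow> (nat \<Rightarrow> nat \<Rightarrow> bool) \<Rightarrow> real" where
  "graph_rho n E = spectral_radius (adj_matrix n E)"

text \<open>H_{n,b} = K_{b-1} join (K_1 union K_{n-b}): vertices 0..b-2 form K_{b-1},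
  vertex b-1 is the K_1, vertices b..n-1 form K_{n-b}.\<close>
definition H_graph :: "nat \<Rightarrow> nat \<Rightarrow> nat \<Rightarrow> nat \<Rightarrow> bool" where
  "H_graph n b i j \<longleftrightarrow> i < n \<and> j < n \<and> i \<noteq> j \<and>
     \<not> (i = b - 1 \<and> b \<le> j) \<and> \<not> (j = b - 1 \<and> b \<le> i)"

definition graph_iso :: "nat \<Rightarrow> (nat \<Rightarrow> nat \<Rightarrow> bool) \<Rightarrow> (nat \<Rightarrow> nat \<Rightarrow> bool) \<Rightarrow> bool" where
  "graph_iso n E1 E2 \<longleftrightarrow> (\<exists>\<pi>. bij_betw \<pi> {0..<n} {0..<n} \<and>
     (\<forall>i<n. \<forall>j<n. E1 i j \<longleftrightarrow> E2 (\<pi> i) (\<pi> j)))"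

definition has_h_factor :: "nat \<Rightarrow> (nat \<Rightarrow> nat \<Rightarrow> bool) \<Rightarrow> (nat \<Rightarrow> nat) \<Rightarrow> bool" where
  "has_h_factor n E h \<longleftrightarrow> (\<exists>F. (\<forall>i j. F i j \<longrightarrow> E i j) \<and> (\<forall>i j. F i j \<longrightarrow> F j i) \<and>
     (\<forall>v<n. card {u. u < n \<and> F v u} = h v))"

definition all_ab_factors :: "nat \<Rightarrow> (nat \<Rightarrow> nat \<Rightarrow> bool) \<Rightarrow> nat \<Rightarrow> nat \<Rightarrow> bool" where
  "all_ab_factors n E a b \<longleftrightarrow> (\<forall>h :: nat \<Rightarrow> nat.
     (\<forall>v<n. 0 < h v \<and> a \<le> h v \<and> h v \<le> b) \<and> even (\<Sum>v<n. h v) \<longrightarrow> has_h_factor n E h)"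

end

theory Submission
  imports Defs "HOL-Analysis.Convex"
begin

text \<open>The graph $H = H_{n,b}$ has a positive eigenvector for some $\mu > n - 2$, so $\rho(G) > n - 2$.
  If some vertex of $G$ has degree less than $b$, then $G$ embeds into $H$ as a spanning subgraph, and
  pairing the modulus of an eigenvector of $G$ with the positive eigenvector of $H$ forces $G \cong H$.
  Otherwise Hong's bound $\rho^2 \le 2m - n + 1$ leaves at most $n - 2$ edges in the complement of $G$.
  Then an $h$-factor can be built directly, without Tutte's theorem: as long as some vertex has more
  than $b$ non-neighbours, remove it, joining it to as many neighbours as it still needs; at most
  $(n - 2)/(b + 1)$ vertices are removed. On what remains, a maximal subgraph with degrees at most the
  prescribed ones is a factor, since otherwise it could be augmented by exchanging one edge for two.\<close>

subsection \<open>Degree-constrained subgraphs\<close>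

text \<open>Edges are two-element sets, so that exchanging edges is insertion and removal in a set
  and no edge is counted in both directions.\<close>

definition edge_set :: "'a set \<Rightarrow> ('a \<Rightarrow> 'a \<Rightarrow> bool) \<Rightarrow> 'a set set" where
  "edge_set V E = {{x, y} |x y. x \<in> V \<and> y \<in> V \<and> x \<noteq> y \<and> E x y}"

text \<open>Excluding \<open>v\<close> itself lets the relation
  \<open>\<lambda>x y. \<not> E x y\<close> yield exactly the neighbours in the complement
  graph.\<close>

definition nbrs :: "'a set \<Rightarrow> ('a \<Rightarrow> 'a \<Rightarrow> bool) \<Rightarrow> 'a \<Rightarrow> 'a set" where
  "nbrs V E v = {u \<in> V. u \<noteq> v \<and> E v u}"

definition edge_deg :: "'a set set \<Rightarrow> 'a \<Rightarrow> nat" where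
  "edge_deg F v = card {e \<in> F. v \<in> e}"

lemma finite_nbrs [simp]: "finite V \<Longrightarrow> finite (nbrs V E v)"
  by (simp add: nbrs_def)

lemma finite_edge_set [simp]: "finite V \<Longrightarrow> finite (edge_set V E)"
  by (rule finite_subset[of _ "Pow V"]) (auto simp: edge_set_def)

lemma edge_deg_sum: "finite F \<Longrightarrow> edge_deg F v = (\<Sum>e\<in>F. of_bool (v \<in> e))"
  by (simp add: edge_deg_def sum_of_bool_eq Int_def)

lemma edge_deg_insert:
  "finite F \<Longrightarrow> e \<notin> F \<Longrightarrow> edge_deg (insert e F) v = edge_deg F v + of_bool (v \<in> e)"
  by (simp add: edge_deg_sum)

lemma edge_deg_remove:
  "finite F \<Longrightarrow> e \<in> F \<Longrightarrow> edge_deg (F - {e}) v + of_bool (v \<in> e) = edge_deg F v"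
  using edge_deg_insert[of "F - {e}" e v] by (simp add: insert_absorb)

lemma edge_deg_union:
  "finite F \<Longrightarrow> finite F' \<Longrightarrow> F \<inter> F' = {} \<Longrightarrow> edge_deg (F \<union> F') v = edge_deg F v + edge_deg F' v"
  by (simp add: edge_deg_sum sum.union_disjoint del: sum_of_bool_eq)

lemma sum_edge_deg:
  assumes "finite V" "finite F"
  shows "(\<Sum>v\<in>V. edge_deg F v) = (\<Sum>e\<in>F. card (V \<inter> e))"
proof -
  have "(\<Sum>v\<in>V. edge_deg F v) = (\<Sum>v\<in>V. \<Sum>e\<in>F. of_bool (v \<in> e))"
    using assms by (simp add: edge_deg_sum)
  also have "\<dots> = (\<Sum>e\<in>F. \<Sum>v\<in>V. of_bool (v \<in> e))"
    by (rule sum.swap)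
  also have "\<dots> = (\<Sum>e\<in>F. card (V \<inter> e))"
    using assms by (intro sum.cong) (simp_all add: sum_of_bool_eq Int_def)
  finally show ?thesis .
qed

lemma handshake:
  assumes "finite V" "F \<subseteq> edge_set V E"
  shows "(\<Sum>v\<in>V. edge_deg F v) = 2 * card F"
proof -
  have "finite F" using assms finite_subset finite_edge_set by metis
  moreover have "card (V \<inter> e) = 2" if e: "e \<in> F" for e
  proof -
    obtain x y where "e = {x, y}" "x \<in> V" "y \<in> V" "x \<noteq> y"
      using assms(2) e unfolding edge_set_def by blast
    then show ?thesis by simp
  qed
  ultimately show ?thesis using assms by (simp add: sum_edge_deg)
qed

lemma edge_deg_eq_card_nbrs:
  assumes "F \<subseteq> edge_set V E"
  shows "card {x. {u, x} \<in> F} = edge_deg F u"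
proof -
  have "(\<lambda>x. {u, x}) ` {x. {u, x} \<in> F} = {e \<in> F. u \<in> e}"
  proof (intro equalityI subsetI)
    fix e assume e: "e \<in> {e \<in> F. u \<in> e}"
    then obtain x y where "e = {x, y}" using assms unfolding edge_set_def by blast
    then have "e = {u, x} \<or> e = {u, y}" using e by auto
    then show "e \<in> (\<lambda>x. {u, x}) ` {x. {u, x} \<in> F}" using e by blast
  qed auto
  then have "bij_betw (\<lambda>x. {u, x}) {x. {u, x} \<in> F} {e \<in> F. u \<in> e}"
    by (auto simp: bij_betw_def inj_on_def doubleton_eq_iff)
  then show ?thesis unfolding edge_deg_def by (rule bij_betw_same_card)
qed

lemma card_edge_set_remove:
  assumes "finite V" "v \<in> V" "\<And>x y. E x y \<Longrightarrow> E y x"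
  shows "card (edge_set V E) = card (edge_set (V - {v}) E) + card (nbrs V E v)"
proof -
  have eq: "edge_set V E = edge_set (V - {v}) E \<union> (\<lambda>u. {v, u}) ` nbrs V E v"
  proof (intro equalityI subsetI)
    fix e assume "e \<in> edge_set V E"
    then obtain x y where xy: "e = {x, y}" "x \<in> V" "y \<in> V" "x \<noteq> y" "E x y"
      by (auto simp: edge_set_def)
    show "e \<in> edge_set (V - {v}) E \<union> (\<lambda>u. {v, u}) ` nbrs V E v"
    proof (cases "v \<in> e")
      case True
      then show ?thesis using xy assms(3)[OF xy(5)] by (auto simp: nbrs_def)
    next
      case False
      then show ?thesis using xy by (auto simp: edge_set_def)
    qed
  next
    fix e assume "e \<in> edge_set (V - {v}) E \<union> (\<lambda>u. {v, u}) ` nbrs V E v"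
    then show "e \<in> edge_set V E"
      using assms(2) by (fastforce simp: edge_set_def nbrs_def)
  qed
  have "edge_set (V - {v}) E \<inter> (\<lambda>u. {v, u}) ` nbrs V E v = {}"
    by (auto simp: edge_set_def)
  moreover have "inj_on (\<lambda>u. {v, u}) (nbrs V E v)"
    by (auto simp: inj_on_def doubleton_eq_iff)
  ultimately show ?thesis
    unfolding eq using assms(1) by (subst card_Un_disjoint) (auto simp: card_image)
qed

text \<open>Let \<open>F\<close> be a maximal subgraph with all degrees at most \<open>g\<close>, with deficient vertices \<open>u\<close>, \<open>w\<close>
  (\<open>u = w\<close> if the deficiency there is at least 2). An edge \<open>{x, y}\<close> of \<open>F\<close> such that \<open>{u, x}\<close> and \<open>{w, y}\<close>
  are unused edges could be exchanged for these two. Hence all \<open>F\<close>-neighbours of the set \<open>X\<close> of vertices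
  available to both \<open>u\<close> and \<open>w\<close> lie in the small set \<open>Y\<close> of vertices available to neither.\<close>

lemma near_complete_factor:
  fixes E :: "'a \<Rightarrow> 'a \<Rightarrow> bool" and g :: "'a \<Rightarrow> nat"
  assumes fin: "finite V"
    and sym: "\<And>x y. E x y \<Longrightarrow> E y x"
    and b3: "3 \<le> b"
    and gb: "\<And>v. v \<in> V \<Longrightarrow> g v \<le> b"
    and ev: "even (\<Sum>v\<in>V. g v)"
    and miss: "\<And>v. v \<in> V \<Longrightarrow> card (nbrs V (\<lambda>x y. \<not> E x y) v) \<le> b"
    and defect: "(\<Sum>v\<in>V. 3 - g v) \<le> D"
    and large: "D + 2 * b^2 + 6 * b < 3 * card V"
  shows "\<exists>F \<subseteq> edge_set V E. \<forall>v\<in>V. edge_deg F v = g v"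
proof -
  define P where "P = {F. F \<subseteq> edge_set V E \<and> (\<forall>v\<in>V. edge_deg F v \<le> g v)}"
  have "{} \<in> P" by (simp add: P_def edge_deg_def)
  moreover have "\<forall>F. F \<in> P \<longrightarrow> card F < Suc (card (edge_set V E))"
    using fin by (auto simp: P_def less_Suc_eq_le intro: card_mono)
  ultimately obtain F where FP: "F \<in> P" and Fmax: "\<And>F'. F' \<in> P \<Longrightarrow> card F' \<le> card F"
    using ex_has_greatest_nat[of "\<lambda>F. F \<in> P" "{}" card] by blast
  have FE: "F \<subseteq> edge_set V E" and Fg: "\<And>v. v \<in> V \<Longrightarrow> edge_deg F v \<le> g v"
    using FP by (auto simp: P_def)
  have finF: "finite F" using FE fin finite_subset finite_edge_set by metis
  have "\<forall>v\<in>V. edge_deg F v = g v"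
  proof (rule ccontr)
    assume "\<not> (\<forall>v\<in>V. edge_deg F v = g v)"
    then obtain u where u: "u \<in> V" "edge_deg F u < g u"
      using Fg by (metis le_neq_implies_less)
    \<comment> \<open>Parity: if \<open>u\<close> were the only deficient vertex and lacked just one
      edge, the sum of \<open>g\<close> would be \<open>2 * card F + 1\<close>.\<close>
    have "\<exists>w\<in>V. edge_deg F w < g w \<and> (w \<noteq> u \<or> edge_deg F u + 2 \<le> g u)"
    proof (rule ccontr)
      assume *: "\<not> ?thesis"
      have "\<not> edge_deg F u + 2 \<le> g u" using * u by blast
      then have gu: "g u = Suc (edge_deg F u)" using u by linarith
      have rest: "g v = edge_deg F v" if "v \<in> V - {u}" for v
        using * Fg[of v] that by force
      have "(\<Sum>v\<in>V. g v) = g u + (\<Sum>v\<in>V-{u}. g v)"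
        by (subst sum.remove[OF fin u(1)]) simp
      also have "\<dots> = Suc (edge_deg F u + (\<Sum>v\<in>V-{u}. edge_deg F v))"
        using gu rest by simp
      also have "\<dots> = Suc (\<Sum>v\<in>V. edge_deg F v)"
        using sum.remove[OF fin u(1), of "edge_deg F"] by simp
      also have "\<dots> = Suc (2 * card F)" using handshake[OF fin FE] by simp
      finally show False using ev by simp
    qed
    then obtain w where w: "w \<in> V" "edge_deg F w < g w" "w \<noteq> u \<or> edge_deg F u + 2 \<le> g u"
      by blast
    have room: "edge_deg F v + of_bool (v = u) + of_bool (v = w) \<le> g v" if "v \<in> V" for v
      using u w Fg[OF that] by (auto simp: of_bool_def)
    define A where "A c = {x \<in> V. x \<noteq> c \<and> E c x \<and> {c, x} \<notin> F}" for c
    have A_edge: "{c, x} \<in> edge_set V E" if "x \<in> A c" "c \<in> V" for c x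
      using that by (auto simp: A_def edge_set_def)
    have sat: "edge_deg F x = g x" if "x \<in> A c" "c \<in> V" "edge_deg F c < g c" for c x
    proof (rule ccontr)
      assume "edge_deg F x \<noteq> g x"
      moreover have x: "x \<in> V" "x \<noteq> c" "{c, x} \<notin> F" using that by (auto simp: A_def)
      ultimately have "edge_deg F x < g x" using Fg by (metis le_neq_implies_less)
      then have "insert {c, x} F \<in> P"
        using FE Fg A_edge[OF that(1,2)] that x finF by (auto simp: P_def edge_deg_insert)
      then show False using Fmax[of "insert {c, x} F"] x finF by simp
    qed
    \<comment> \<open>Outside \<open>A c\<close> lie only \<open>c\<close>, at most \<open>b\<close>
      non-neighbours and, since \<open>c\<close> is deficient, at most \<open>b - 1\<close>
      neighbours along \<open>F\<close>.\<close>
    have compl: "card (V - A c) \<le> 2 * b" if "c \<in> V" "edge_deg F c < g c" for c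
    proof -
      have finN: "finite {x. {c, x} \<in> F}"
        by (rule finite_subset[of _ V]) (use FE fin in \<open>auto simp: edge_set_def doubleton_eq_iff\<close>)
      have "V - A c \<subseteq> insert c (nbrs V (\<lambda>x y. \<not> E x y) c \<union> {x. {c, x} \<in> F})"
        by (auto simp: A_def nbrs_def)
      then have "card (V - A c) \<le> card (insert c (nbrs V (\<lambda>x y. \<not> E x y) c \<union> {x. {c, x} \<in> F}))"
        using fin finN by (intro card_mono) auto
      also have "\<dots> \<le> Suc (card (nbrs V (\<lambda>x y. \<not> E x y) c) + card {x. {c, x} \<in> F})"
        using card_Un_le[of "nbrs V (\<lambda>x y. \<not> E x y) c" "{x. {c, x} \<in> F}"] fin finN
        by (simp add: card_insert_if)
      also have "\<dots> \<le> 2 * b"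
        using miss[OF that(1)] gb[OF that(1)] that(2) edge_deg_eq_card_nbrs[OF FE, of c] by simp
      finally show ?thesis .
    qed
    have key: False if xy: "{x, y} \<in> F" "x \<in> A u" "y \<in> A w" for x y
    proof -
      let ?F' = "insert {u, x} (insert {w, y} (F - {{x, y}}))"
      have x: "x \<in> V" "x \<noteq> u" "{u, x} \<notin> F" and y: "y \<in> V" "y \<noteq> w" "{w, y} \<notin> F"
        using xy by (auto simp: A_def)
      have "x \<noteq> y" using xy FE by (auto simp: edge_set_def doubleton_eq_iff)
      \<comment> \<open>As \<open>x \<noteq> y\<close>, equality would force \<open>u = y\<close>
        and \<open>w = x\<close>, and then \<open>{u, x}\<close> would be the edge
        \<open>{x, y}\<close> of \<open>F\<close>.\<close>
      have "{u, x} \<noteq> {w, y}"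
        using xy x y \<open>x \<noteq> y\<close> by (auto simp: doubleton_eq_iff insert_commute)
      have "edge_deg ?F' z \<le> g z" if "z \<in> V" for z
      proof -
        have "edge_deg ?F' z = edge_deg (F - {{x, y}}) z + of_bool (z \<in> {w, y}) + of_bool (z \<in> {u, x})"
          using finF x y \<open>{u, x} \<noteq> {w, y}\<close> by (subst edge_deg_insert; simp add: edge_deg_insert)
        moreover have "edge_deg (F - {{x, y}}) z + of_bool (z \<in> {x, y}) = edge_deg F z"
          using finF xy by (intro edge_deg_remove)
        moreover have "of_bool (z \<in> {x, y}) = of_bool (z = x) + (of_bool (z = y) :: nat)"
          using \<open>x \<noteq> y\<close> by auto
        moreover have "of_bool (z \<in> {w, y}) = of_bool (z = w) + (of_bool (z = y) :: nat)"
          using y by auto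
        moreover have "of_bool (z \<in> {u, x}) = of_bool (z = u) + (of_bool (z = x) :: nat)"
          using x by auto
        ultimately show ?thesis using room[OF that] by linarith
      qed
      then have "?F' \<in> P"
        using FE A_edge[OF xy(2) u(1)] A_edge[OF xy(3) w(1)] by (auto simp: P_def)
      moreover have "card ?F' = Suc (card F)"
      proof -
        have "card ?F' = Suc (Suc (card (F - {{x, y}})))"
          using finF x y \<open>{u, x} \<noteq> {w, y}\<close> by simp
        also have "\<dots> = Suc (card F)" using xy finF by (simp only: card_Suc_Diff1)
        finally show ?thesis .
      qed
      ultimately show False using Fmax[of ?F'] by simp
    qed
    define X where "X = A u \<inter> A w"
    define Y where "Y = V - (A u \<union> A w)"
    have finXY: "finite X" "finite Y" "finite (A u)" "finite (A w)"
      using fin by (auto simp: X_def Y_def A_def)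
    have AV: "A u \<subseteq> V" "A w \<subseteq> V" by (auto simp: A_def)
    have XV: "X \<subseteq> V" and YV: "Y \<subseteq> V" by (auto simp: X_def Y_def A_def)
    have edge_XY: "card (X \<inter> e) \<le> card (Y \<inter> e)" if e: "e \<in> F" for e
    proof (cases "X \<inter> e = {}")
      case False
      then obtain x where x: "x \<in> X" "x \<in> e" by blast
      obtain y where y: "e = {x, y}" "y \<in> V"
        using e FE x(2) by (auto simp: edge_set_def)
      have "y \<notin> A w" using key[of x y] e x y by (auto simp: X_def)
      moreover have "y \<notin> A u" using key[of y x] e x y by (auto simp: X_def insert_commute)
      ultimately have "y \<in> Y" "y \<notin> X" using y by (auto simp: X_def Y_def)
      then have "X \<inter> e = {x}" "{y} \<subseteq> Y \<inter> e" using x y by auto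
      then show ?thesis using card_mono[of "Y \<inter> e" "{y}"] finXY(2)
        by simp
    qed simp
    \<comment> \<open>Vertices of \<open>X\<close> are saturated, so the sum counts ends of
      \<open>F\<close>-edges in \<open>X\<close>. By \<open>edge_XY\<close> there are no more of
      these than ends in \<open>Y\<close>, where degrees are at most \<open>b\<close>.\<close>
    have "(\<Sum>x\<in>X. g x) = (\<Sum>x\<in>X. edge_deg F x)"
      using sat u by (intro sum.cong) (auto simp: X_def)
    also have "\<dots> = (\<Sum>e\<in>F. card (X \<inter> e))" using finXY finF by (simp add: sum_edge_deg)
    also have "\<dots> \<le> (\<Sum>e\<in>F. card (Y \<inter> e))" by (intro sum_mono edge_XY)
    also have "\<dots> = (\<Sum>y\<in>Y. edge_deg F y)" using finXY finF by (simp add: sum_edge_deg)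
    also have "\<dots> \<le> card Y * b"
      using sum_bounded_above[of Y "edge_deg F" b] Fg gb YV by (metis order_trans subsetD of_nat_id)
    finally have gXY: "(\<Sum>x\<in>X. g x) \<le> card Y * b" .
    have "3 * card X = (\<Sum>x\<in>X. 3)" by simp
    also have "\<dots> \<le> (\<Sum>x\<in>X. g x + (3 - g x))" by (intro sum_mono) simp
    also have "\<dots> = (\<Sum>x\<in>X. g x) + (\<Sum>x\<in>X. 3 - g x)" by (rule sum.distrib)
    also have "(\<Sum>x\<in>X. 3 - g x) \<le> (\<Sum>x\<in>V. 3 - g x)"
      using fin XV by (intro sum_mono2) auto
    finally have cX: "3 * card X \<le> card Y * b + D" using gXY defect by linarith
    have "card (V - A u) + card (A u) = card V" "card (V - A w) + card (A w) = card V"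
      using fin AV by (simp_all add: card_Diff_subset card_mono finite_subset)
    moreover have "card (A u) + card (A w) = card (A u \<union> A w) + card X"
      unfolding X_def using finXY by (intro card_Un_Int)
    moreover have "card Y + card (A u \<union> A w) = card V"
      unfolding Y_def using fin AV by (simp add: card_Diff_subset card_mono finite_subset)
    moreover have cu: "card (V - A u) \<le> 2 * b" using compl u by blast
    moreover have "card (V - A w) \<le> 2 * b" using compl w by blast
    ultimately have cV: "card V + card Y \<le> card X + 4 * b" by linarith
    have "card Y \<le> card (V - A u)"
      unfolding Y_def using fin by (intro card_mono) auto
    then have "card Y \<le> 2 * b" using cu by simp
    \<comment> \<open>Eliminating \<open>card X\<close> from \<open>cX\<close> and \<open>cV\<close>
      gives \<open>3 * card V \<le> D + (b - 3) * card Y + 12 * b\<close>. With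
      \<open>card Y \<le> 2 * b\<close> the right side is at most
      \<open>D + 2 * b^2 + 6 * b\<close>, against \<open>large\<close>. Here \<open>c\<close> is
      \<open>b - 3\<close> without truncated subtraction.\<close>
    obtain c where c: "b = c + 3" using b3 by (metis add.commute le_Suc_ex)
    have "card Y * c \<le> 2 * b * c" using \<open>card Y \<le> 2 * b\<close> by simp
    then show False using cX cV large unfolding c by (simp add: algebra_simps power2_eq_square)
  qed
  then show ?thesis using FE by blast
qed

section \<open>Removing a vertex and restoring it\<close>

lemma edge_set_mono: "V \<subseteq> W \<Longrightarrow> edge_set V E \<subseteq> edge_set W E"
  unfolding edge_set_def by blast

text \<open>Undoes the removal of \<open>v\<close>: the star from \<open>v\<close> to
  \<open>S\<close> gives \<open>v\<close> its degree and returns to each vertex of \<open>S\<close>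
  the unit taken from it. Positivity of \<open>g\<close> on \<open>S\<close> makes the truncated
  subtraction exact.\<close>

lemma extend_factor:
  assumes fin: "finite V" and v: "v \<in> V" and S: "S \<subseteq> nbrs V E v" "card S = g v"
    and pos: "\<And>u. u \<in> S \<Longrightarrow> 0 < g u"
    and F: "F \<subseteq> edge_set (V - {v}) E" "\<And>u. u \<in> V - {v} \<Longrightarrow> edge_deg F u = g u - of_bool (u \<in> S)"
  shows "\<exists>F \<subseteq> edge_set V E. \<forall>u\<in>V. edge_deg F u = g u"
proof -
  let ?T = "(\<lambda>u. {v, u}) ` S"
  have SV: "S \<subseteq> V - {v}" and SE: "\<And>u. u \<in> S \<Longrightarrow> E v u" using S by (auto simp: nbrs_def)
  have finS: "finite S" using SV fin finite_subset by blast
  have finF: "finite F" using F(1) fin finite_subset finite_edge_set by (metis finite_Diff)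
  have T: "?T \<subseteq> edge_set V E"
    using v SV SE by (fastforce simp: edge_set_def)
  have F': "F \<subseteq> edge_set V E" 
    using F(1) edge_set_mono[of "V - {v}" V E] by blast
  have vF: "v \<notin> e" if "e \<in> F" for e
    using F(1) that unfolding edge_set_def by blast
  have disj: "F \<inter> ?T = {}" using vF by auto
  have "{x. {v, x} \<in> ?T} = S" by (auto simp: doubleton_eq_iff)
  then have Tv: "edge_deg ?T v = g v" using edge_deg_eq_card_nbrs[OF T, of v] S(2) by simp
  have Tu: "edge_deg ?T u = of_bool (u \<in> S)" if "u \<noteq> v" for u
  proof -
    have "{e \<in> ?T. u \<in> e} = (if u \<in> S then {{v, u}} else {})" using that by auto
    then show ?thesis by (simp add: edge_deg_def)
  qed
  have Fv: "edge_deg F v = 0" 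
  proof -
    have "{e \<in> F. v \<in> e} = {}" using vF by blast
    then show ?thesis unfolding edge_deg_def by (simp only: card.empty)
  qed
  have "edge_deg (F \<union> ?T) u = g u" if "u \<in> V" for u
    using edge_deg_union[OF finF finite_imageI[OF finS] disj] Tv Tu Fv F(2)[of u] pos[of u] that
    by (cases "u = v") (auto simp: of_bool_def)
  then show ?thesis using T F' by (metis Un_least)
qed

text \<open>Bookkeeping for one removal. The total drops by \<open>g v\<close> for \<open>v\<close>
  and by \<open>card S = g v\<close> for the chosen neighbours, so parity is kept; each chosen
  neighbour adds at most one to the defect.\<close>

lemma sum_remove_chosen:
  fixes g :: "'a \<Rightarrow> nat"
  assumes "finite V" "v \<in> V" "S \<subseteq> V - {v}" "card S = g v" "\<And>u. u \<in> S \<Longrightarrow> 0 < g u"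
  shows "(\<Sum>u\<in>V - {v}. g u - of_bool (u \<in> S)) + 2 * g v = (\<Sum>u\<in>V. g u)"
    and "(\<Sum>u\<in>V - {v}. 3 - (g u - of_bool (u \<in> S))) \<le> (\<Sum>u\<in>V. 3 - g u) + g v"
proof -
  have S: "(\<Sum>u\<in>V - {v}. of_bool (u \<in> S)) = g v"
    using assms(1,4) Int_absorb1[OF assms(3)] by simp
  have "(\<Sum>u\<in>V - {v}. g u - of_bool (u \<in> S)) + (\<Sum>u\<in>V - {v}. of_bool (u \<in> S)) = (\<Sum>u\<in>V - {v}. g u)"
    unfolding sum.distrib[symmetric] using assms(5) by (intro sum.cong) (auto simp: Suc_le_eq)
  then show "(\<Sum>u\<in>V - {v}. g u - of_bool (u \<in> S)) + 2 * g v = (\<Sum>u\<in>V. g u)"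
    unfolding S using sum.remove[OF assms(1,2), of g] by simp
  have "(\<Sum>u\<in>V - {v}. 3 - (g u - of_bool (u \<in> S))) \<le> (\<Sum>u\<in>V - {v}. (3 - g u) + of_bool (u \<in> S))"
    by (intro sum_mono) auto
  also have "\<dots> = (\<Sum>u\<in>V - {v}. 3 - g u) + g v" unfolding sum.distrib S ..
  also have "(\<Sum>u\<in>V - {v}. 3 - g u) \<le> (\<Sum>u\<in>V. 3 - g u)"
    using assms(1) by (intro sum_mono2) auto
  finally show "(\<Sum>u\<in>V - {v}. 3 - (g u - of_bool (u \<in> S))) \<le> (\<Sum>u\<in>V. 3 - g u) + g v" by simp
qed

lemma card_nbrs_complement:
  assumes "finite V" "v \<in> V"
  shows "card (nbrs V E v) + card (nbrs V (\<lambda>x y. \<not> E x y) v) + 1 = card V"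
proof -
  have "card (nbrs V E v) + card (nbrs V (\<lambda>x y. \<not> E x y) v)
      = card (nbrs V E v \<union> nbrs V (\<lambda>x y. \<not> E x y) v)"
    using assms by (intro card_Un_disjoint[symmetric]) (auto simp: nbrs_def)
  also have "nbrs V E v \<union> nbrs V (\<lambda>x y. \<not> E x y) v = V - {v}" by (auto simp: nbrs_def)
  finally show ?thesis using card_Suc_Diff1[OF assms] by simp
qed

lemma nbrs_remove_le: "finite V \<Longrightarrow> card (nbrs (V - {w}) E v) \<le> card (nbrs V E v)"
  by (intro card_mono) (auto simp: nbrs_def)

lemma card_nbrs_le_edge_set:
  assumes "finite V" "v \<in> V" "\<And>x y. E x y \<Longrightarrow> E y x"
  shows "card (nbrs V E v) \<le> card (edge_set V E)"
  using card_edge_set_remove[OF assms] by simp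

text \<open>The size condition of \<open>near_complete_factor\<close> after \<open>s\<close>
  removals, with \<open>D = s * b\<close>. Multiplying its negation by \<open>b + 1\<close> allows
  the bound on \<open>s * (b + 1)\<close> to be inserted and leaves
  \<open>n < (b + 3) * (b + 1)\<close>, impossible since \<open>b * b \<ge> 9\<close>.\<close>

lemma defect_arith:
  fixes b n s :: nat
  assumes "2 * b^2 + 4 * b \<le> n" "s * (b + 1) + 2 \<le> n" "3 \<le> b"
  shows "s * b + 2 * b^2 + 6 * b < 3 * (n - s)"
proof (rule ccontr)
  assume "\<not> ?thesis"
  moreover have "s \<le> n" using assms(2) by simp
  ultimately have "3 * n \<le> s * (b + 3) + (2 * b^2 + 6 * b)" by (simp add: algebra_simps)
  then have "3 * n * (b + 1) \<le> (s * (b + 3) + (2 * b^2 + 6 * b)) * (b + 1)"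
    by (rule mult_le_mono1)
  moreover have "s * (b + 1) * (b + 3) + 2 * (b + 3) \<le> n * (b + 3)"
    using mult_le_mono1[OF assms(2), of "b + 3"] by (simp only: add_mult_distrib)
  ultimately have "3 * n * (b + 1) + 2 * (b + 3) \<le> n * (b + 3) + (2 * b^2 + 6 * b) * (b + 1)"
    by (simp add: algebra_simps)
  then have "2 * b * n < 2 * b * ((b + 3) * (b + 1))"
    by (simp add: algebra_simps power2_eq_square)
  then have "n < (b + 3) * (b + 1)" by simp
  moreover have "3 * 3 \<le> b * b" using assms(3) by (intro mult_le_mono)
  ultimately show False using assms(1) by (simp add: algebra_simps power2_eq_square)
qed

text \<open>Here \<open>s\<close> counts the vertices removed so far from a graph with \<open>n\<close> vertices. Each of them lost more
  than \<open>b\<close> edges of the complement and lowered the prescribed degrees by at most \<open>b\<close> in total.\<close>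

lemma sparse_complement_factor:
  fixes E :: "'a \<Rightarrow> 'a \<Rightarrow> bool" and g :: "'a \<Rightarrow> nat"
  assumes sym: "\<And>x y. E x y \<Longrightarrow> E y x"
    and b3: "3 \<le> b"
    and n: "2 * b^2 + 4 * b \<le> n"
  shows "finite V \<Longrightarrow> card V + s = n \<Longrightarrow> 1 \<le> s \<Longrightarrow> (\<And>v. v \<in> V \<Longrightarrow> g v \<le> b) \<Longrightarrow>
    even (\<Sum>v\<in>V. g v) \<Longrightarrow>
    card (edge_set V (\<lambda>x y. \<not> E x y)) + s * (b + 1) + 2 \<le> n \<Longrightarrow>
    (\<And>v. v \<in> V \<Longrightarrow> 2 * card (nbrs V (\<lambda>x y. \<not> E x y) v) + 2 \<le> n) \<Longrightarrow>
    (\<Sum>v\<in>V. 3 - g v) \<le> s * b \<Longrightarrow>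
    \<exists>F \<subseteq> edge_set V E. \<forall>v\<in>V. edge_deg F v = g v"
proof (induction "card V" arbitrary: V g s rule: less_induct)
  case (less V g s)
  let ?M = "\<lambda>x y. \<not> E x y"
  have symM: "?M y x" if "?M x y" for x y using sym that by blast
  show ?case
  proof (cases "\<forall>v\<in>V. card (nbrs V ?M v) \<le> b")
    case True
    have "s * b + 2 * b^2 + 6 * b < 3 * (n - s)"
      using defect_arith[OF n _ b3, of s] less.prems(6) by simp
    moreover have "card V = n - s" using less.prems(2) by simp
    ultimately show ?thesis
      using near_complete_factor[OF less.prems(1) sym b3 less.prems(4,5) _ less.prems(8)] True
      by simp
  next
    case False
    then obtain v where v: "v \<in> V" "b < card (nbrs V ?M v)" by (auto simp: not_le)
    \<comment> \<open>\<open>N\<close> holds the neighbours of \<open>v\<close> that can still take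
      an edge. Each vertex of \<open>Z\<close> contributes 3 to the defect, so \<open>Z\<close> is
      small.\<close>
    define N where "N = {u \<in> nbrs V E v. 0 < g u}"
    define Z where "Z = {u \<in> V. g u = 0}"
    have finNZ: "finite N" "finite Z" using less.prems(1) by (auto simp: N_def Z_def)
    have "nbrs V E v \<subseteq> N \<union> Z" by (auto simp: N_def Z_def nbrs_def)
    then have "card (nbrs V E v) \<le> card (N \<union> Z)" using finNZ by (intro card_mono) auto
    then have NZ: "card (nbrs V E v) \<le> card N + card Z" using card_Un_le[of N Z] by linarith
    have "3 * card Z = (\<Sum>u\<in>Z. 3 - g u)" by (simp add: Z_def)
    also have "\<dots> \<le> (\<Sum>u\<in>V. 3 - g u)"
      using less.prems(1) by (intro sum_mono2) (auto simp: Z_def)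
    finally have Z: "3 * card Z \<le> s * b" using less.prems(8) by simp
    have tot: "card (nbrs V E v) + card (nbrs V ?M v) + 1 + s = n"
      using card_nbrs_complement[OF less.prems(1) v(1), of E] less.prems(2) by simp
    \<comment> \<open>For \<open>s \<ge> 2\<close> the bound on complement edges leaves
      \<open>v\<close> more than \<open>s * b\<close> neighbours, at most \<open>s * b / 3\<close>
      of them in \<open>Z\<close>. For \<open>s = 1\<close> this would fall short, and the
      hypothesis that at most about half of the vertices are non-neighbours is used instead.\<close>
    have "b \<le> card N"
    proof (cases "s = 1")
      case True
      have "b * b \<ge> 3 * b" using b3 by simp
      then show ?thesis
        using True NZ Z tot less.prems(7)[OF v(1)] n b3 by (simp add: power2_eq_square)
    next
      case False
      then have "2 * b \<le> s * b" using less.prems(3) by simp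
      then show ?thesis
        using NZ Z tot card_nbrs_le_edge_set[of V v ?M, OF less.prems(1) v(1) symM] less.prems(6)
        unfolding add_mult_distrib2 mult_1_right by linarith
    qed
    then obtain S where S: "S \<subseteq> N" "card S = g v"
      using less.prems(4)[OF v(1)] by (meson obtain_subset_with_card_n order_trans)
    have SN: "S \<subseteq> nbrs V E v" and SV: "S \<subseteq> V - {v}" and Spos: "\<And>u. u \<in> S \<Longrightarrow> 0 < g u"
      using S by (auto simp: N_def nbrs_def)
    note rem = sum_remove_chosen[where g = g, OF less.prems(1) v(1) SV S(2) Spos]
    have "\<exists>F \<subseteq> edge_set (V - {v}) E. \<forall>u\<in>V - {v}. edge_deg F u = g u - of_bool (u \<in> S)"
    proof (rule less.hyps[of "V - {v}" "Suc s"])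
      show "card (V - {v}) < card V" using v(1) less.prems(1) by (intro card_Diff1_less)
      show "card (V - {v}) + Suc s = n"
        using card_Suc_Diff1[OF less.prems(1) v(1)] less.prems(2) by simp
      show "even (\<Sum>u\<in>V - {v}. g u - of_bool (u \<in> S))"
        using rem(1) less.prems(5) by presburger
      show "card (edge_set (V - {v}) ?M) + Suc s * (b + 1) + 2 \<le> n"
        using card_edge_set_remove[of V v ?M, OF less.prems(1) v(1) symM] less.prems(6) v(2) by simp
      show "2 * card (nbrs (V - {v}) ?M u) + 2 \<le> n" if "u \<in> V - {v}" for u
        using nbrs_remove_le[OF less.prems(1), of v ?M u] less.prems(7)[of u] that by simp
      show "(\<Sum>u\<in>V - {v}. 3 - (g u - of_bool (u \<in> S))) \<le> Suc s * b"
        using rem(2) less.prems(8) less.prems(4)[OF v(1)] by simp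
      show "g u - of_bool (u \<in> S) \<le> b" if "u \<in> V - {v}" for u
        using less.prems(4)[of u] that by simp
    qed (use less.prems in auto)
    then show ?thesis using extend_factor[where S = S and g = g, OF less.prems(1) v(1) SN S(2) Spos] by blast
  qed
qed

text \<open>The first removal is treated apart: there the minimum degree supplies the neighbours,
  and the defect is still zero. Removing a vertex with the most non-neighbours prepares the case
  \<open>s = 1\<close> of \<open>sparse_complement_factor\<close>.\<close>

lemma min_degree_factor:
  fixes E :: "'a \<Rightarrow> 'a \<Rightarrow> bool" and g :: "'a \<Rightarrow> nat"
  assumes sym: "\<And>x y. E x y \<Longrightarrow> E y x"
    and fin: "finite V"
    and large: "2 * b^2 + 4 * b \<le> card V"
    and g3: "\<And>v. v \<in> V \<Longrightarrow> 3 \<le> g v" and gb: "\<And>v. v \<in> V \<Longrightarrow> g v \<le> b"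
    and ev: "even (\<Sum>v\<in>V. g v)"
    and mind: "\<And>v. v \<in> V \<Longrightarrow> b \<le> card (nbrs V E v)"
    and sparse: "card (edge_set V (\<lambda>x y. \<not> E x y)) + 2 \<le> card V"
  shows "\<exists>F \<subseteq> edge_set V E. \<forall>v\<in>V. edge_deg F v = g v"
proof -
  let ?M = "\<lambda>x y. \<not> E x y"
  have symM: "?M y x" if "?M x y" for x y using sym that by blast
  have "V \<noteq> {}" using sparse by auto
  then have b3: "3 \<le> b" using g3 gb by (meson all_not_in_conv order_trans)
  have def0: "(\<Sum>v\<in>V. 3 - g v) = 0" using g3 by simp
  obtain v0 where "v0 \<in> V" using \<open>V \<noteq> {}\<close> by blast
  moreover have "\<forall>u. u \<in> V \<longrightarrow> card (nbrs V ?M u) < Suc (card V)"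
    using fin by (auto simp: nbrs_def less_Suc_eq_le intro: card_mono)
  ultimately obtain v where v: "v \<in> V"
      and vmax: "\<And>u. u \<in> V \<Longrightarrow> card (nbrs V ?M u) \<le> card (nbrs V ?M v)"
    using ex_has_greatest_nat[of "\<lambda>v. v \<in> V" v0 "\<lambda>v. card (nbrs V ?M v)"] by blast
  show ?thesis
  proof (cases "card (nbrs V ?M v) \<le> b")
    case True
    have "0 + 2 * b^2 + 6 * b < 3 * card V"
      using large b3 defect_arith[of b "card V" 0] by simp
    moreover have "card (nbrs V ?M u) \<le> b" if "u \<in> V" for u
      using vmax[OF that] True by simp
    ultimately show ?thesis
      using near_complete_factor[where D = 0 and g = g, OF fin sym b3 gb ev] def0 by simp
  next
    case False
    obtain S where S: "S \<subseteq> nbrs V E v" "card S = g v"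
      using mind[OF v] gb[OF v] by (meson obtain_subset_with_card_n order_trans)
    have SV: "S \<subseteq> V - {v}" using S by (auto simp: nbrs_def)
    have Spos: "\<And>u. u \<in> S \<Longrightarrow> 0 < g u" using SV g3 by fastforce
    note rem = sum_remove_chosen[where g = g, OF fin v SV S(2) Spos]
    have "\<exists>F \<subseteq> edge_set (V - {v}) E. \<forall>u\<in>V - {v}. edge_deg F u = g u - of_bool (u \<in> S)"
    proof (rule sparse_complement_factor[where s = 1 and b = b and n = "card V"])
      show "card (V - {v}) + 1 = card V" using card_Suc_Diff1[OF fin v] by simp
      show "even (\<Sum>u\<in>V - {v}. g u - of_bool (u \<in> S))"
        using rem(1) ev by presburger
      have *: "card (edge_set (V - {v}) ?M) + card (nbrs V ?M v) + 2 \<le> card V"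
        using card_edge_set_remove[of V v ?M, OF fin v symM] sparse by simp
      then show "card (edge_set (V - {v}) ?M) + 1 * (b + 1) + 2 \<le> card V" using False by simp
      \<comment> \<open>The number of non-neighbours of \<open>u\<close> is bounded both by that of
        \<open>v\<close> and by the number of remaining complement edges. These two bounds add up to
        at most \<open>card V - 2\<close>.\<close>
      show "2 * card (nbrs (V - {v}) ?M u) + 2 \<le> card V" if "u \<in> V - {v}" for u
      proof -
        have "card (nbrs (V - {v}) ?M u) \<le> card (edge_set (V - {v}) ?M)"
          using fin that symM by (intro card_nbrs_le_edge_set) auto
        then show ?thesis
          using * nbrs_remove_le[OF fin, of v ?M u] vmax[of u] that by simp
      qed
      show "(\<Sum>u\<in>V - {v}. 3 - (g u - of_bool (u \<in> S))) \<le> 1 * b"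
        using rem(2) def0 gb[OF v] by simp
      show "g u - of_bool (u \<in> S) \<le> b" if "u \<in> V - {v}" for u
        using gb[of u] that by simp
    qed (use sym b3 large fin in auto)
    then show ?thesis using extend_factor[where S = S and g = g, OF fin v S Spos] by blast
  qed
qed

subsection \<open>Spectral radius\<close>

lemma adj_matrix_mult_index:
  "i < n \<Longrightarrow> (adj_matrix n E *\<^sub>v vec n x) $ i = (\<Sum>j<n. of_bool (E i j) * x j)"
  by (simp add: adj_matrix_def scalar_prod_def lessThan_atLeast0 of_bool_def)

text \<open>The spectral radius is the maximum of moduli over the complex spectrum, so it is
  attained at a complex \<open>k\<close>; the later estimates work with moduli of entries.\<close>

lemma graph_rho_eigenvector:
  assumes "0 < n"
  obtains k x where "graph_rho n E = cmod k"
    "\<And>i. i < n \<Longrightarrow> (\<Sum>j<n. of_bool (E i j) * x j) = k * x i" "\<exists>i<n. x i \<noteq> 0"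
proof -
  have A: "adj_matrix n E \<in> carrier_mat n n" by (simp add: adj_matrix_def)
  obtain k where k: "graph_rho n E = cmod k" "eigenvalue (adj_matrix n E) k"
    using spectral_radius_mem_max(1)[OF A assms] by (auto simp: graph_rho_def spectrum_def)
  obtain v where v: "v \<in> carrier_vec n" "v \<noteq> 0\<^sub>v n" "adj_matrix n E *\<^sub>v v = k \<cdot>\<^sub>v v"
    using k(2) A unfolding eigenvalue_def eigenvector_def by auto
  have v_eq: "v = vec n (($) v)" using v(1) by auto
  show ?thesis
  proof (rule that[OF k(1)])
    fix i assume "i < n"
    then show "(\<Sum>j<n. of_bool (E i j) * v $ j) = k * v $ i"
      using adj_matrix_mult_index[of i n E "($) v"] v v_eq by (metis carrier_vecD index_smult_vec(1))
  next
    show "\<exists>i<n. v $ i \<noteq> 0" using v(1,2) by (metis carrier_vecD eq_vecI index_zero_vec)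
  qed
qed

lemma eigenvector_le_graph_rho:
  fixes z :: "nat \<Rightarrow> real"
  assumes ev: "\<And>i. i < n \<Longrightarrow> (\<Sum>j<n. of_bool (E i j) * z j) = \<mu> * z i" and nz: "k < n" "z k \<noteq> 0"
  shows "\<mu> \<le> graph_rho n E"
proof -
  have A: "adj_matrix n E \<in> carrier_mat n n" by (simp add: adj_matrix_def)
  let ?v = "vec n (\<lambda>i. complex_of_real (z i))"
  have "adj_matrix n E *\<^sub>v ?v = complex_of_real \<mu> \<cdot>\<^sub>v ?v"
  proof (rule eq_vecI)
    fix i assume "i < dim_vec (complex_of_real \<mu> \<cdot>\<^sub>v ?v)"
    then have i: "i < n" by simp
    have "(\<Sum>j<n. of_bool (E i j) * complex_of_real (z j)) = complex_of_real (\<Sum>j<n. of_bool (E i j) * z j)"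
      by simp
    then show "(adj_matrix n E *\<^sub>v ?v) $ i = (complex_of_real \<mu> \<cdot>\<^sub>v ?v) $ i"
      using i by (simp only: adj_matrix_mult_index ev) simp
  qed (simp add: adj_matrix_def)
  moreover have "?v \<noteq> 0\<^sub>v n" 
  proof
    assume "?v = 0\<^sub>v n"
    then have "?v $ k = 0\<^sub>v n $ k" by simp
    then show False using nz by simp
  qed
  ultimately have "eigenvalue (adj_matrix n E) (complex_of_real \<mu>)"
    using A unfolding eigenvalue_def eigenvector_def by (intro exI[of _ ?v]) simp
  then have "\<bar>\<mu>\<bar> \<le> graph_rho n E"
    unfolding graph_rho_def
    using nz by (intro spectral_radius_mem_max(2)[OF A]) (force simp: spectrum_def)+
  then show ?thesis by simp
qed

text \<open>Hong's bound $\rho^2 \le 2m - n + 1$.\<close>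

lemma graph_rho_square_le:
  assumes n: "0 < n" and sym: "\<And>x y. E x y \<Longrightarrow> E y x" and irr: "\<And>x. \<not> E x x"
    and deg: "\<And>v. v < n \<Longrightarrow> 0 < card (nbrs {..<n} E v)"
  shows "(graph_rho n E)\<^sup>2 + (real n - 1) \<le> real (\<Sum>v<n. card (nbrs {..<n} E v))"
proof -
  let ?V = "{..<n}" and ?M = "\<lambda>x y. \<not> E x y"
  let ?N = "nbrs ?V E"
  define m where "m = (\<Sum>v<n. card (?N v))"
  obtain k x where k: "graph_rho n E = cmod k"
    and ev: "\<And>i. i < n \<Longrightarrow> (\<Sum>j<n. of_bool (E i j) * x j) = k * x i"
    and nz: "\<exists>i<n. x i \<noteq> 0"
    using graph_rho_eigenvector[OF n, of E] by blast
  define w where "w u = (cmod (x u))\<^sup>2" for u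
  have sum_N: "(\<Sum>j<n. of_bool (E i j) * f j) = (\<Sum>j\<in>?N i. f j)" for f :: "nat \<Rightarrow> 'c::comm_semiring_1" and i
  proof -
    have "(\<Sum>j\<in>?N i. f j) = (\<Sum>j\<in>?N i. of_bool (E i j) * f j)"
      by (intro sum.cong) (auto simp: nbrs_def)
    also have "\<dots> = (\<Sum>j<n. of_bool (E i j) * f j)"
      using irr by (intro sum.mono_neutral_left) (auto simp: nbrs_def)
    finally show ?thesis ..
  qed
  \<comment> \<open>Triangle inequality and Cauchy-Schwarz, applied to one row of the eigenvalue
    equation.\<close>
  have row: "(cmod k)\<^sup>2 * w v \<le> card (?N v) * (\<Sum>u\<in>?N v. w u)" if "v < n" for v
  proof -
    have "cmod k * cmod (x v) = cmod (\<Sum>u\<in>?N v. x u)"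
      using ev[OF that] sum_N[of v x] by (simp add: norm_mult)
    also have "\<dots> \<le> (\<Sum>u\<in>?N v. cmod (x u))" by (rule norm_sum)
    finally have "(cmod k * cmod (x v))\<^sup>2 \<le> (\<Sum>u\<in>?N v. cmod (x u))\<^sup>2"
      by (intro power_mono) auto
    also have "\<dots> \<le> (\<Sum>u\<in>?N v. w u) * card (?N v)"
      unfolding w_def by (rule sum_squared_le_sum_of_squares)
    finally show ?thesis by (simp add: w_def power_mult_distrib mult.commute)
  qed
  \<comment> \<open>The degree sum \<open>m\<close> splits over \<open>u\<close>, its neighbours and
    its non-neighbours. Each of the \<open>n - 1 - card (?N u)\<close> non-neighbours has degree at
    least 1.\<close>
  have col: "real (\<Sum>v\<in>?N u. card (?N v)) \<le> real m - (real n - 1)" if u: "u < n" for u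
  proof -
    have split: "?V = insert u (?N u \<union> nbrs ?V ?M u)" using u by (auto simp: nbrs_def)
    have "u \<notin> ?N u \<union> nbrs ?V ?M u" "?N u \<inter> nbrs ?V ?M u = {}" by (auto simp: nbrs_def)
    then have "m = card (?N u) + ((\<Sum>v\<in>?N u. card (?N v)) + (\<Sum>v\<in>nbrs ?V ?M u. card (?N v)))"
      unfolding m_def by (subst split) (simp add: sum.union_disjoint)
    moreover have "card (nbrs ?V ?M u) \<le> (\<Sum>v\<in>nbrs ?V ?M u. card (?N v))"
      using sum_mono[of "nbrs ?V ?M u" "\<lambda>_. 1" "\<lambda>v. card (?N v)"] deg
      by (fastforce simp: nbrs_def Suc_le_eq)
    moreover have "card (?N u) + card (nbrs ?V ?M u) + 1 = n"
      using card_nbrs_complement[of ?V u E] u by simp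
    ultimately show ?thesis by linarith
  qed
  \<comment> \<open>After summing the rows and swapping the sums, the coefficient of
    \<open>w u\<close> is the degree sum over the neighbours of \<open>u\<close>, which
    \<open>col\<close> bounds.\<close>
  have "(cmod k)\<^sup>2 * (\<Sum>v<n. w v) \<le> (\<Sum>v<n. card (?N v) * (\<Sum>u\<in>?N v. w u))"
    by (subst sum_distrib_left) (intro sum_mono row, auto)
  also have "\<dots> = (\<Sum>v<n. \<Sum>u<n. card (?N v) * (of_bool (E v u) * w u))"
    unfolding sum_N[symmetric] sum_distrib_left ..
  also have "\<dots> = (\<Sum>u<n. \<Sum>v<n. card (?N v) * (of_bool (E v u) * w u))" by (rule sum.swap)
  also have "\<dots> = (\<Sum>u<n. w u * (\<Sum>v<n. of_bool (E u v) * real (card (?N v))))"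
    unfolding sum_distrib_left using sym by (intro sum.cong refl) (auto simp: of_bool_def)
  also have "\<dots> = (\<Sum>u<n. w u * real (\<Sum>v\<in>?N u. card (?N v)))"
    unfolding sum_N by simp
  also have "\<dots> \<le> (\<Sum>u<n. w u * (real m - (real n - 1)))"
    using col by (intro sum_mono mult_left_mono) (auto simp: w_def)
  also have "\<dots> = (real m - (real n - 1)) * (\<Sum>v<n. w v)"
    by (simp add: sum_distrib_right mult.commute sum_distrib_left)
  finally have "(cmod k)\<^sup>2 * (\<Sum>v<n. w v) \<le> (real m - (real n - 1)) * (\<Sum>v<n. w v)" .
  moreover have "0 < (\<Sum>v<n. w v)"
    using nz by (auto simp: w_def intro!: sum_pos2)
  ultimately have "(cmod k)\<^sup>2 \<le> real m - (real n - 1)" by simp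
  then show ?thesis unfolding k m_def by simp
qed

text \<open>Compare the entrywise modulus of an eigenvector of \<open>E\<close> with the positive eigenvector \<open>z\<close> of \<open>K\<close>.\<close>

lemma subgraph_eq_of_graph_rho_ge:
  fixes z :: "nat \<Rightarrow> real"
  assumes symK: "\<And>i j. K i j \<Longrightarrow> K j i"
    and sub: "\<And>i j. i < n \<Longrightarrow> j < n \<Longrightarrow> E i j \<Longrightarrow> K i j"
    and c: "c < n" "\<And>i. i < n \<Longrightarrow> i \<noteq> c \<Longrightarrow> K i c"
    and zpos: "\<And>i. i < n \<Longrightarrow> 0 < z i"
    and zev: "\<And>i. i < n \<Longrightarrow> (\<Sum>j<n. of_bool (K i j) * z j) = \<mu> * z i"
    and \<mu>: "0 < \<mu>" "\<mu> \<le> graph_rho n E"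
    and ij: "i < n" "j < n"
  shows "E i j \<longleftrightarrow> K i j"
proof -
  define \<rho> where "\<rho> = graph_rho n E"
  have n0: "0 < n" using c by simp
  have \<rho>: "0 < \<rho>" "\<mu> \<le> \<rho>" using \<mu> by (auto simp: \<rho>_def)
  obtain k x where k: "\<rho> = cmod k"
    and ev: "\<And>i. i < n \<Longrightarrow> (\<Sum>j<n. of_bool (E i j) * x j) = k * x i"
    and nz: "\<exists>i<n. x i \<noteq> 0"
    using graph_rho_eigenvector[OF n0, of E] unfolding \<rho>_def by blast
  define y where "y i = cmod (x i)" for i
  have y0: "0 \<le> y i" for i by (simp add: y_def)
  have Ey: "\<rho> * y i \<le> (\<Sum>j<n. of_bool (E i j) * y j)" if "i < n" for i
  proof -
    have "\<rho> * y i = cmod (\<Sum>j<n. of_bool (E i j) * x j)"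
      using ev[OF that] by (simp add: k y_def norm_mult)
    also have "\<dots> \<le> (\<Sum>j<n. cmod (of_bool (E i j) * x j))" by (rule norm_sum)
    also have "\<dots> = (\<Sum>j<n. of_bool (E i j) * y j)"
      by (intro sum.cong) (auto simp: y_def norm_mult)
    finally show ?thesis .
  qed
  have EK: "(\<Sum>j<n. of_bool (E i j) * y j) \<le> (\<Sum>j<n. of_bool (K i j) * y j)" if "i < n" for i
    using sub[OF that] y0 by (intro sum_mono) (auto simp: of_bool_def)
  \<comment> \<open>By symmetry \<open>z\<close> is also a left eigenvector of \<open>K\<close>, so
    the sum is \<open>\<mu> - \<rho>\<close> times the inner product of \<open>z\<close> and
    \<open>y\<close>. Its terms are nonnegative, hence all vanish.\<close>
  have "(\<Sum>i<n. z i * ((\<Sum>j<n. of_bool (K i j) * y j) - \<rho> * y i)) \<le> 0"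
  proof -
    have "(\<Sum>i<n. z i * (\<Sum>j<n. of_bool (K i j) * y j)) = (\<Sum>i<n. \<Sum>j<n. z i * (of_bool (K i j) * y j))"
      by (simp only: sum_distrib_left)
    also have "\<dots> = (\<Sum>j<n. \<Sum>i<n. z i * (of_bool (K i j) * y j))" by (rule sum.swap)
    also have "\<dots> = (\<Sum>j<n. (\<Sum>i<n. of_bool (K j i) * z i) * y j)"
      unfolding sum_distrib_right using symK by (intro sum.cong refl) (auto simp: of_bool_def)
    also have "\<dots> = (\<Sum>j<n. \<mu> * z j * y j)" using zev by simp
    also have "\<dots> \<le> (\<Sum>j<n. \<rho> * z j * y j)"
      using \<rho> zpos y0 by (intro sum_mono mult_right_mono) (auto simp: less_imp_le)
    finally show ?thesis
      by (simp add: right_diff_distrib sum_subtractf mult.left_commute mult.assoc)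
  qed
  moreover have term0: "0 \<le> z i * ((\<Sum>j<n. of_bool (K i j) * y j) - \<rho> * y i)" if "i < n" for i
    using zpos[OF that] Ey[OF that] EK[OF that] by (intro mult_nonneg_nonneg) auto
  ultimately have "(\<Sum>i<n. z i * ((\<Sum>j<n. of_bool (K i j) * y j) - \<rho> * y i)) = 0"
    by (intro antisym sum_nonneg) auto
  then have "z i * ((\<Sum>j<n. of_bool (K i j) * y j) - \<rho> * y i) = 0" if "i < n" for i
    using term0 that by (subst (asm) sum_nonneg_eq_0_iff) auto
  then have Ky: "(\<Sum>j<n. of_bool (K i j) * y j) = \<rho> * y i" if "i < n" for i
    using zpos that by fastforce
  have nbr_le: "y j \<le> \<rho> * y i" if "i < n" "j < n" "K i j" for i j
    using member_le_sum[of j "{..<n}" "\<lambda>j. of_bool (K i j) * y j"] Ky that y0 by simp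
  obtain k' where k': "k' < n" "0 < y k'" using nz by (auto simp: y_def)
  \<comment> \<open>Positivity passes from some nonzero entry to \<open>c\<close>, which is adjacent
    to all other vertices, and from \<open>c\<close> to every vertex.\<close>
  have yc: "0 < y c"
  proof (cases "k' = c")
    case False
    then have "0 < \<rho> * y c" using nbr_le[of c k'] c k' symK by force
    then show ?thesis using \<rho> by (simp add: zero_less_mult_iff)
  qed (use k' in simp)
  have ypos: "0 < y i" if "i < n" for i
  proof (cases "i = c")
    case False
    then have "0 < \<rho> * y i" using nbr_le[of i c] c that yc by force
    then show ?thesis using \<rho> by (simp add: zero_less_mult_iff)
  qed (use yc in simp)
  have "(\<Sum>j<n. of_bool (K i j) * y j - of_bool (E i j) * y j) = 0"
    using Ey[of i] EK[of i] Ky[of i] ij by (simp add: sum_subtractf)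
  then have "of_bool (K i j) * y j - of_bool (E i j) * y j = 0"
    using ij sub y0 by (subst (asm) sum_nonneg_eq_0_iff) (auto simp: of_bool_def)
  then show ?thesis using ypos[of j] ij by (auto simp: of_bool_def split: if_splits)
qed

subsection \<open>The extremal graph\<close>

lemma H_graph_sym: "H_graph n b i j \<Longrightarrow> H_graph n b j i"
  by (auto simp: H_graph_def)

text \<open>The cubic \<open>f\<close> in the proof is the characteristic polynomial of the quotient matrix of the partition of
  $H_{n,b}$ into its three parts. It changes sign between $n - 2$ and $n - 1$.\<close>

lemma H_graph_positive_eigenvector:
  assumes "2 \<le> b" "b < n"
  obtains \<mu> :: real and z :: "nat \<Rightarrow> real" where "real n - 2 < \<mu>" "\<And>i. 0 < z i"
    "\<And>i. i < n \<Longrightarrow> (\<Sum>j<n. of_bool (H_graph n b i j) * z j) = \<mu> * z i"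
proof -
  \<comment> \<open>The parts have sizes \<open>c\<close>, 1 and \<open>d\<close>;
    \<open>c = b - 1\<close> is also the index of the single vertex. Thus \<open>c + d - 1\<close>
    is \<open>n - 2\<close>.\<close>
  obtain c where c: "b = Suc c" "1 \<le> c" using assms by (cases b) auto
  obtain d where d: "n = c + 1 + d" "1 \<le> d" using assms c by (metis Suc_eq_plus1 less_imp_add_positive One_nat_def Suc_le_eq)
  define f where "f \<mu> = (\<mu> - (real c - 1)) * \<mu> * (\<mu> - (real d - 1)) - c * (\<mu> - (real d - 1)) - real d * c * \<mu>" for \<mu> :: real
  have cd: "1 \<le> real c" "1 \<le> real d" using c d by auto
  have f1: "f (real c + d - 1) = - (real c)\<^sup>2"
    by (simp add: f_def algebra_simps power2_eq_square)
  have "f (real c + d) = (real c + d) * (real c + d + 1) - c * (real c + 1)"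
    by (simp add: f_def algebra_simps)
  also have "\<dots> = real d * (2 * c + d + 1)" by (simp add: algebra_simps)
  finally have f2: "0 \<le> f (real c + d)" by simp
  have "\<exists>\<mu>\<ge>real c + d - 1. \<mu> \<le> real c + d \<and> f \<mu> = 0"
    using f1 f2 by (intro IVT') (auto simp: f_def intro!: continuous_intros)
  then obtain \<mu> where \<mu>: "real c + d - 1 \<le> \<mu>" "f \<mu> = 0" by blast
  have "\<mu> \<noteq> real c + d - 1" using f1 \<mu>(2) cd by auto
  then have \<mu>1: "real c + d - 1 < \<mu>" using \<mu> by simp
  then have \<mu>2: "0 < \<mu>" "0 < \<mu> - (real d - 1)" using cd by auto
  \<comment> \<open>With value 1 on the first clique, \<open>q\<close> on the single vertex and
    \<open>r\<close> on the second clique, the last two rows of the quotient system determine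
    \<open>q\<close> and \<open>r\<close>; the first row \<open>p\<close> then amounts to
    \<open>f \<mu> = 0\<close>.\<close>
  define q where "q = c / \<mu>"
  define r where "r = c / (\<mu> - (real d - 1))"
  have q: "\<mu> * q = c" "0 < q" and r: "\<mu> * r = c + (real d - 1) * r" "0 < r"
    using \<mu>2 cd by (auto simp: q_def r_def field_simps)
  have wr: "(\<mu> - (real d - 1)) * r = c" using \<mu>2 by (simp add: r_def)
  have "\<mu> * (\<mu> - (real d - 1)) * (real c - 1 + q + d * r - \<mu>)
      = (real c - 1 - \<mu>) * \<mu> * (\<mu> - (real d - 1)) + (\<mu> * q) * (\<mu> - (real d - 1))
        + d * \<mu> * ((\<mu> - (real d - 1)) * r)"
    by (simp add: algebra_simps)
  also have "\<dots> = - f \<mu>" unfolding q(1) wr by (simp add: f_def algebra_simps)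
  finally have "\<mu> * (\<mu> - (real d - 1)) * (real c - 1 + q + d * r - \<mu>) = - f \<mu>" .
  then have p: "real c - 1 + q + d * r = \<mu>" using \<mu> \<mu>2 by simp
  define z where "z i = (if i < c then 1 else if i = c then q else r)" for i :: nat
  have split: "(\<Sum>j<n. g j) = (\<Sum>j<c. g j) + g c + (\<Sum>j\<in>{Suc c..<n}. g j)" for g :: "nat \<Rightarrow> real"
  proof -
    have "Suc c \<le> n" using d by simp
    from ivl_disj_un_one(2)[OF this]
    have "(\<Sum>j<n. g j) = sum g ({..<Suc c} \<union> {Suc c..<n})" by (rule arg_cong[OF sym])
    also have "\<dots> = (\<Sum>j<Suc c. g j) + (\<Sum>j\<in>{Suc c..<n}. g j)"
      by (intro sum.union_disjoint) auto
    finally have "(\<Sum>j<n. g j) = (\<Sum>j<Suc c. g j) + (\<Sum>j\<in>{Suc c..<n}. g j)" .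
    then show ?thesis by simp
  qed
  have count: "(\<Sum>j\<in>A. of_bool (i \<noteq> j) * y) = (real (card A) - 1) * y"
    if "finite A" "i \<in> A" for A and i :: nat and y :: real
  proof -
    have "(\<Sum>j\<in>A. of_bool (i \<noteq> j) * y) = (\<Sum>j\<in>A - {i}. y)"
      using that by (subst sum.remove[OF that]) (auto intro!: sum.cong)
    also have "\<dots> = real (card (A - {i})) * y" by simp
    also have "real (card (A - {i})) = real (card A) - 1"
      using card_Suc_Diff1[OF that] by linarith
    finally show ?thesis .
  qed
  show ?thesis
  proof (rule that[of \<mu> z])
    show "real n - 2 < \<mu>" using \<mu>1 d by simp
    show "0 < z i" for i using q r by (simp add: z_def)
    fix i assume i: "i < n"
    let ?t = "\<lambda>j. of_bool (H_graph n b i j) * z j"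
    consider "i < c" | "i = c" | "c < i" by linarith
    then show "(\<Sum>j<n. ?t j) = \<mu> * z i"
    proof cases
      case 1
      have "(\<Sum>j<c. ?t j) = (\<Sum>j<c. of_bool (i \<noteq> j) * 1)"
        using 1 c d by (intro sum.cong) (auto simp: H_graph_def z_def)
      also have "\<dots> = real c - 1" using count[of "{..<c}" i 1] 1 by simp
      finally have s1: "(\<Sum>j<c. ?t j) = real c - 1" .
      have s2: "?t c = q" using 1 c d by (auto simp: H_graph_def z_def)
      have "(\<Sum>j\<in>{Suc c..<n}. ?t j) = (\<Sum>j\<in>{Suc c..<n}. r)"
        using 1 c d by (intro sum.cong) (auto simp: H_graph_def z_def)
      also have "\<dots> = d * r" using d by simp
      finally have s3: "(\<Sum>j\<in>{Suc c..<n}. ?t j) = d * r" .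
      have "z i = 1" using 1 by (simp add: z_def)
      then show ?thesis unfolding split s1 s2 s3 using p by simp
    next
      case 2
      have "(\<Sum>j<c. ?t j) = (\<Sum>j<c. 1)"
        using 2 c d by (intro sum.cong) (auto simp: H_graph_def z_def)
      then have s1: "(\<Sum>j<c. ?t j) = c" by simp
      have s2: "?t c = 0" using 2 by (auto simp: H_graph_def)
      have s3: "(\<Sum>j\<in>{Suc c..<n}. ?t j) = 0"
        using 2 c d by (intro sum.neutral) (auto simp: H_graph_def)
      have "z i = q" using 2 by (simp add: z_def)
      then show ?thesis unfolding split s1 s2 s3 using q by simp
    next
      case 3
      have "(\<Sum>j<c. ?t j) = (\<Sum>j<c. 1)"
        using 3 c d i by (intro sum.cong) (auto simp: H_graph_def z_def)
      then have s1: "(\<Sum>j<c. ?t j) = c" by simp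
      have s2: "?t c = 0" using 3 c by (auto simp: H_graph_def)
      have "(\<Sum>j\<in>{Suc c..<n}. ?t j) = (\<Sum>j\<in>{Suc c..<n}. of_bool (i \<noteq> j) * r)"
        using 3 c i by (intro sum.cong) (auto simp: H_graph_def z_def)
      also have "\<dots> = (real d - 1) * r" using count[of "{Suc c..<n}" i r] 3 d i by simp
      finally have s3: "(\<Sum>j\<in>{Suc c..<n}. ?t j) = (real d - 1) * r" .
      have "z i = r" using 3 by (simp add: z_def)
      then show ?thesis unfolding split s1 s2 s3 using r by simp
    qed
  qed
qed

text \<open>The only pairs missing in \<open>H_graph n b\<close> join \<open>b - 1\<close> to larger
  indices. It suffices to send \<open>v\<close> to \<open>b - 1\<close> and a set \<open>T\<close>
  of \<open>b - 1\<close> vertices containing all neighbours of \<open>v\<close> to the indices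
  below it.\<close>

lemma low_degree_embedding:
  assumes sym: "\<And>x y. E x y \<Longrightarrow> E y x" and irr: "\<And>x. \<not> E x x"
    and v: "v < n" "card (nbrs {..<n} E v) < b" and b: "b < n"
  obtains \<pi> where "bij_betw \<pi> {..<n} {..<n}"
    "\<And>i j. i < n \<Longrightarrow> j < n \<Longrightarrow> E i j \<Longrightarrow> H_graph n b (\<pi> i) (\<pi> j)"
proof -
  let ?N = "nbrs {..<n} E v"
  obtain c where c: "b = Suc c" using v by (cases b) auto
  have N: "?N \<subseteq> {..<n} - {v}" "card ?N \<le> c" using v c by (auto simp: nbrs_def)
  have card_V: "card ({..<n} - {v}) = n - 1" using v by simp
  obtain T where T: "?N \<subseteq> T" "T \<subseteq> {..<n} - {v}" "card T = c"
    using exists_subset_between[of ?N c "{..<n} - {v}"] N card_V b c by fastforce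
  define R where "R = {..<n} - {v} - T"
  have fin: "finite T" "finite R" using T by (auto simp: R_def intro: finite_subset)
  have "card R = n - 1 - c" unfolding R_def using T card_V fin by (simp add: card_Diff_subset)
  then have "card R = card {Suc c..<n}" by simp
  then obtain f2 where f2: "bij_betw f2 R {Suc c..<n}"
    using finite_same_card_bij[OF fin(2)] by blast
  have "card T = card {..<c}" using T by simp
  then obtain f1 where f1: "bij_betw f1 T {..<c}"
    using finite_same_card_bij[OF fin(1)] by blast
  define \<pi> where "\<pi> i = (if i = v then c else if i \<in> T then f1 i else f2 i)" for i
  have V: "{..<n} = T \<union> ({v} \<union> R)" "{..<n} = {..<c} \<union> ({c} \<union> {Suc c..<n})"
    using T v b c by (auto simp: R_def)
  have "bij_betw \<pi> T {..<c}"
    using f1 T by (subst bij_betw_cong[of _ _ f1]) (auto simp: \<pi>_def)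
  moreover have "bij_betw \<pi> R {Suc c..<n}"
    using f2 by (subst bij_betw_cong[of _ _ f2]) (auto simp: \<pi>_def R_def)
  moreover have "bij_betw \<pi> {v} {c}" by (simp add: \<pi>_def)
  ultimately have bij: "bij_betw \<pi> {..<n} {..<n}"
    by (subst V(1), subst V(2)) (intro bij_betw_combine, auto)
  have \<pi>n: "\<pi> i < n" if "i < n" for i using bij_betw_apply[OF bij, of i] that by simp
  have \<pi>T: "\<pi> i < c" if "i \<in> T" for i
    using bij_betw_apply[OF \<open>bij_betw \<pi> T {..<c}\<close> that] by simp
  have \<pi>v: "\<pi> i = c \<longleftrightarrow> i = v" if "i < n" for i
    using inj_on_eq_iff[OF bij_betw_imp_inj_on[OF bij], of i v] that v by (simp add: \<pi>_def)
  show ?thesis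
  proof (rule that[OF bij])
    fix i j assume ij: "i < n" "j < n" "E i j"
    then have "i \<noteq> j" using irr by auto
    then have "\<pi> i \<noteq> \<pi> j" using inj_on_eq_iff[OF bij_betw_imp_inj_on[OF bij], of i j] ij by simp
    moreover have "j \<in> T" if "i = v" using that ij irr T by (auto simp: nbrs_def)
    moreover have "i \<in> T" if "j = v" using that ij irr T sym by (auto simp: nbrs_def)
    ultimately show "H_graph n b (\<pi> i) (\<pi> j)"
      using \<pi>n ij \<pi>v \<pi>T by (fastforce simp: H_graph_def c)
  qed
qed

section \<open>Counting complement edges and assembling the theorem\<close>

lemma card_edge_set_complement:
  assumes "finite V" and sym: "\<And>x y. E x y \<Longrightarrow> E y x"
  shows "(\<Sum>v\<in>V. card (nbrs V E v)) + 2 * card (edge_set V (\<lambda>x y. \<not> E x y)) = card V * (card V - 1)"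
proof -
  let ?M = "\<lambda>x y. \<not> E x y"
  have "edge_deg (edge_set V ?M) v = card (nbrs V ?M v)" if "v \<in> V" for v
  proof -
    have "{x. {v, x} \<in> edge_set V ?M} = nbrs V ?M v"
      using that sym by (auto simp: edge_set_def nbrs_def doubleton_eq_iff)
    then show ?thesis using edge_deg_eq_card_nbrs[of "edge_set V ?M" V ?M v] by simp
  qed
  then have "2 * card (edge_set V ?M) = (\<Sum>v\<in>V. card (nbrs V ?M v))"
    using handshake[of V "edge_set V ?M" ?M] assms(1) by simp
  then have "(\<Sum>v\<in>V. card (nbrs V E v)) + 2 * card (edge_set V ?M)
      = (\<Sum>v\<in>V. card (nbrs V E v) + card (nbrs V ?M v))"
    by (simp add: sum.distrib)
  also have "\<dots> = (\<Sum>v\<in>V. card V - 1)"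
    using card_nbrs_complement[OF assms(1), of _ E] by (intro sum.cong) fastforce+
  finally show ?thesis by simp
qed

lemma edge_set_doubletonD:
  assumes "{x, y} \<in> edge_set V E" and "\<And>x y. E x y \<Longrightarrow> E y x"
  shows "x \<in> V" "y \<in> V" "E x y"
  using assms by (auto simp: edge_set_def doubleton_eq_iff)

lemma has_h_factorI:
  assumes F: "F \<subseteq> edge_set {..<n} E" "\<forall>v<n. edge_deg F v = h v"
    and sym: "\<And>x y. E x y \<Longrightarrow> E y x"
  shows "has_h_factor n E h"
  unfolding has_h_factor_def
proof (intro exI[of _ "\<lambda>x y. {x, y} \<in> F"] conjI allI impI)
  show "E i j" if "{i, j} \<in> F" for i j
    using edge_set_doubletonD(3)[of i j "{..<n}" E] that F(1) sym by blast
  show "{j, i} \<in> F" if "{i, j} \<in> F" for i j using that by (simp add: insert_commute)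
  fix v assume "v < n"
  have "{u. u < n \<and> {v, u} \<in> F} = {u. {v, u} \<in> F}"
    using edge_set_doubletonD(2)[of v _ "{..<n}" E] F(1) sym by blast
  then show "card {u. u < n \<and> {v, u} \<in> F} = h v"
    using F(2) \<open>v < n\<close> edge_deg_eq_card_nbrs[OF F(1)] by simp
qed

theorem theorem1p7:
  fixes a b n :: nat and E :: "nat \<Rightarrow> nat \<Rightarrow> bool"
  assumes "3 \<le> a" and "a < b"
    and "simple_graph n E"
    and "n \<ge> 2 * b ^ 2 + 4 * b"
    and "graph_rho n E \<ge> graph_rho n (H_graph n b)"
  shows "all_ab_factors n E a b \<or> graph_iso n E (H_graph n b)"
proof -
  let ?V = "{..<n}" and ?M = "\<lambda>x y. \<not> E x y"
  have sym: "E y x" if "E x y" for x y using that assms(3) unfolding simple_graph_def by blast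
  have irr: "\<not> E x x" for x using assms(3) unfolding simple_graph_def by blast
  have b: "2 \<le> b" "b < n" using assms(1,2,4) by auto
  obtain \<mu> z where \<mu>: "real n - 2 < \<mu>" and z: "\<And>i. 0 < z i"
    and ev: "\<And>i. i < n \<Longrightarrow> (\<Sum>j<n. of_bool (H_graph n b i j) * z j) = \<mu> * z i"
    using H_graph_positive_eigenvector[OF b] by blast
  have "z 0 \<noteq> 0" using z[of 0] by simp
  then have \<mu>E: "\<mu> \<le> graph_rho n E"
    using eigenvector_le_graph_rho[OF ev, of 0] b assms(5) by simp
  show ?thesis
  proof (cases "\<exists>v<n. card (nbrs ?V E v) < b")
    case True
    then obtain v where v: "v < n" "card (nbrs ?V E v) < b" by blast
    obtain \<pi> where bij: "bij_betw \<pi> ?V ?V"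
      and emb: "\<And>i j. i < n \<Longrightarrow> j < n \<Longrightarrow> E i j \<Longrightarrow> H_graph n b (\<pi> i) (\<pi> j)"
      using low_degree_embedding[OF sym irr v b(2)] by blast
    have \<pi>n: "\<pi> i < n" if "i < n" for i using bij_betw_apply[OF bij, of i] that by simp
    \<comment> \<open>Index 0 lies in the part \<open>K_{b-1}\<close> because
      \<open>b \<ge> 2\<close>, so its preimage is adjacent to every other vertex in the pulled-back
      graph.\<close>
    obtain c where c: "c < n" "\<pi> c = 0"
      using bij b by (metis bij_betw_imp_surj_on imageE lessThan_iff less_nat_zero_code gr0I)
    have "E i j \<longleftrightarrow> H_graph n b (\<pi> i) (\<pi> j)" if "i < n" "j < n" for i j
    proof (rule subgraph_eq_of_graph_rho_ge[where K = "\<lambda>i j. H_graph n b (\<pi> i) (\<pi> j)" and z = "z \<circ> \<pi>"])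
      show "H_graph n b (\<pi> i) (\<pi> c)" if "i < n" "i \<noteq> c" for i
      proof -
        have "\<pi> i \<noteq> 0" using bij_betw_imp_inj_on[OF bij] that c by (metis inj_onD lessThan_iff)
        then show ?thesis using \<pi>n[OF that(1)] c b by (auto simp: H_graph_def)
      qed
      show "(\<Sum>j<n. of_bool (H_graph n b (\<pi> i) (\<pi> j)) * (z \<circ> \<pi>) j) = \<mu> * (z \<circ> \<pi>) i" if "i < n" for i
        using ev[OF \<pi>n[OF that]] sum.reindex_bij_betw[OF bij, of "\<lambda>j. of_bool (H_graph n b (\<pi> i) j) * z j"]
        by simp
    qed (use emb c z \<mu> \<mu>E b that H_graph_sym in auto)
    then show ?thesis
      using bij unfolding graph_iso_def lessThan_atLeast0 by blast
  next
    case False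
    then have deg: "b \<le> card (nbrs ?V E v)" if "v < n" for v using that by (meson not_le)
    \<comment> \<open>Hong's bound and \<open>\<rho> > n - 2\<close> give a degree sum above
      \<open>(n - 2)^2 + (n - 1)\<close>. Subtracting from \<open>n * (n - 1)\<close> leaves fewer
      than \<open>2 * n - 3\<close> for twice the complement edges, hence at most
      \<open>n - 2\<close> of them by integrality.\<close>
    have "(real n - 2)\<^sup>2 < (graph_rho n E)\<^sup>2"
      using \<mu> \<mu>E b by (intro power_strict_mono) auto
    moreover have "(graph_rho n E)\<^sup>2 + (real n - 1) \<le> real (\<Sum>v<n. card (nbrs ?V E v))"
      using b deg irr sym by (intro graph_rho_square_le) (auto intro: less_le_trans[of 0 b])
    moreover have "real (\<Sum>v<n. card (nbrs ?V E v)) + 2 * real (card (edge_set ?V ?M)) = real n * (real n - 1)"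
    proof -
      have "real ((\<Sum>v<n. card (nbrs ?V E v)) + 2 * card (edge_set ?V ?M)) = real (n * (n - 1))"
        using card_edge_set_complement[of ?V E] sym by simp
      then show ?thesis using b by (simp add: of_nat_diff)
    qed
    ultimately have "2 * real (card (edge_set ?V ?M)) < 2 * real n - 3"
      by (simp add: power2_eq_square algebra_simps)
    then have sparse: "card (edge_set ?V ?M) + 2 \<le> card ?V" by simp
    have "all_ab_factors n E a b"
      unfolding all_ab_factors_def
    proof (intro allI impI)
      fix h :: "nat \<Rightarrow> nat"
      assume h: "(\<forall>v<n. 0 < h v \<and> a \<le> h v \<and> h v \<le> b) \<and> even (\<Sum>v<n. h v)"
      have "\<exists>F \<subseteq> edge_set ?V E. \<forall>v\<in>?V. edge_deg F v = h v"
      proof (rule min_degree_factor)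
        show "3 \<le> h v" if "v \<in> ?V" for v using h assms(1) that by (meson lessThan_iff order_trans)
      qed (use h sym deg sparse assms(4) in auto)
      then show "has_h_factor n E h" using has_h_factorI sym by (metis lessThan_iff)
    qed
    then show ?thesis ..
  qed
qed

end
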